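(* Let $1 \to F \xrightarrow{\alpha} G \xrightarrow{\beta} H \to 1$ be a computable short exact sequence of groups such that: (i) for every $\varphi \in A_G$, the group $F$ has solvable $\varphi$-twisted conjugacy problem; (ii) $H$ has solvable conjugacy problem; (iii) for every $h \in H$ with $h \neq 1$, the subgroup $\langle h \rangle$ has finite index in its centralizer $C_H(h)$, and a corresponding set of coset representatives of $\langle h\rangle$ in $C_H(h)$ can be computed. Then $G$ has solvable word problem.
   Context: Groups are given by finite generating sets, and elements are represented by words in the generators and their inverses. The word problem of a group is: given a word, decide whether it represents $1$. The conjugacy problem is: given words $x,y$, decide whether there is $g$ in the group with $y = g^{-1} x g$. "Solvable" means decidable by an algorithm. The short exact sequence is called computable if images and pre-images via the morphisms $\alpha$ and $\beta$ can be computed: given a word for an element of $F$ (resp. $G$), one can compute a word for its image under $\alpha$ (resp. $\beta$); given a word for an element of $H$, one can compute a word for some $\beta$-preimage in $G$; and given a word for an element of $\alpha(F) \leqslant G$, one can compute a word for its $\alpha$-preimage in $F$. Identify $F$ with the normal subgroup $\alpha(F)$ of $G$. For $g\in G$ the inner automorphism $x \mapsto g^{-1} x g$ of $G$ restricts to an automorphism $\varphi_g$ of $F$. The action subgroup is $A_G = \{\varphi_g \mid g \in G\} \leqslant \operatorname{Aut}(F)$. For $\varphi \in \operatorname{Aut}(F)$, the $\varphi$-twisted conjugacy problem for $F$ is: given $x,y \in F$, decide whether there is $g \in F$ with $y = g^{-1} x\, \varphi(g)$. *)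

theory Defs
  imports "HOL-Algebra.Algebra" "HOL-Library.Nat_Bijection"
begin

definition minimize :: "(nat list \<rightharpoonup> nat) \<Rightarrow> (nat list \<rightharpoonup> nat)" where
  "minimize f xs =
     (if \<exists>k. f (k # xs) = Some 0 \<and> (\<forall>j<k. \<exists>v. f (j # xs) = Some (Suc v))
      then Some (LEAST k. f (k # xs) = Some 0) else None)"

text \<open>
  \<open>partial_recursive n f\<close>: the partial function that \<open>f\<close> induces on argument lists of length
  \<open>n\<close> is partial recursive (\<open>None\<close> is divergence). The values of \<open>f\<close> on lists of any other
  length carry no meaning.
\<close>

inductive partial_recursive :: "nat \<Rightarrow> (nat list \<rightharpoonup> nat) \<Rightarrow> bool" where
  zero: "partial_recursive n (\<lambda>xs. Some 0)"
| succ: "partial_recursive 1 (\<lambda>xs. Some (Suc (hd xs)))"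
| proj: "i < n \<Longrightarrow> partial_recursive n (\<lambda>xs. Some (xs ! i))"
| comp: "partial_recursive (length gs) f \<Longrightarrow> \<forall>g\<in>set gs. partial_recursive n g \<Longrightarrow>
    partial_recursive n (\<lambda>xs. Option.bind (those (map (\<lambda>g. g xs) gs)) f)"
| prim_rec: "partial_recursive n f \<Longrightarrow> partial_recursive (n + 2) g \<Longrightarrow>
    partial_recursive (n + 1)
      (\<lambda>xs. rec_nat (f (tl xs)) (\<lambda>k r. Option.bind r (\<lambda>v. g (k # v # tl xs))) (hd xs))"
| mu: "partial_recursive (n + 1) f \<Longrightarrow> partial_recursive n (minimize f)"

datatype letter = Gen nat | Inv nat

type_synonym word = "letter list"

primrec letter_index :: "letter \<Rightarrow> nat" where
  "letter_index (Gen i) = i"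
| "letter_index (Inv i) = i"

definition words :: "nat \<Rightarrow> word set" where
  "words n = {w. \<forall>l\<in>set w. letter_index l < n}"

primrec letter_val :: "('a, 'm) monoid_scheme \<Rightarrow> 'a list \<Rightarrow> letter \<Rightarrow> 'a" where
  "letter_val G S (Gen i) = S ! i"
| "letter_val G S (Inv i) = inv\<^bsub>G\<^esub> (S ! i)"

definition word_val :: "('a, 'm) monoid_scheme \<Rightarrow> 'a list \<Rightarrow> word \<Rightarrow> 'a" where
  "word_val G S w = foldr (\<lambda>l x. letter_val G S l \<otimes>\<^bsub>G\<^esub> x) w \<one>\<^bsub>G\<^esub>"

definition generating_family :: "('a, 'm) monoid_scheme \<Rightarrow> 'a list \<Rightarrow> bool" where
  "generating_family G S \<longleftrightarrow> set S \<subseteq> carrier G \<and> generate G (set S) = carrier G"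

primrec letter_code :: "letter \<Rightarrow> nat" where
  "letter_code (Gen i) = 2 * i"
| "letter_code (Inv i) = 2 * i + 1"

definition word_code :: "word \<Rightarrow> nat" where
  "word_code w = list_encode (map letter_code w)"

text \<open>
  \<open>can_compute code D R\<close>: some algorithm turns every input word \<open>w\<close> in \<open>D\<close> into (the code of) an
  output related to \<open>w\<close> by \<open>R\<close>. On words outside \<open>D\<close> it may diverge or return anything.
\<close>

definition can_compute :: "('o \<Rightarrow> nat) \<Rightarrow> word set \<Rightarrow> (word \<Rightarrow> 'o \<Rightarrow> bool) \<Rightarrow> bool" where
  "can_compute code D R \<longleftrightarrow>
     (\<exists>f. partial_recursive 1 f \<and> (\<forall>w\<in>D. \<exists>v. f [word_code w] = Some (code v) \<and> R w v))"

definition solvable_word_problem :: "('a, 'm) monoid_scheme \<Rightarrow> 'a list \<Rightarrow> bool" where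
  "solvable_word_problem G S \<longleftrightarrow>
     (\<exists>d. partial_recursive 1 d \<and>
        (\<forall>w\<in>words (length S). d [word_code w] = Some (of_bool (word_val G S w = \<one>\<^bsub>G\<^esub>))))"

definition solvable_conjugacy_problem :: "('a, 'm) monoid_scheme \<Rightarrow> 'a list \<Rightarrow> bool" where
  "solvable_conjugacy_problem G S \<longleftrightarrow>
     (\<exists>d. partial_recursive 2 d \<and>
        (\<forall>u\<in>words (length S). \<forall>v\<in>words (length S).
           d [word_code u, word_code v] =
             Some (of_bool (\<exists>g\<in>carrier G.
               word_val G S v = inv\<^bsub>G\<^esub> g \<otimes>\<^bsub>G\<^esub> word_val G S u \<otimes>\<^bsub>G\<^esub> g))))"

definition solvable_twisted_conjugacy_problem ::
  "('a, 'm) monoid_scheme \<Rightarrow> 'a list \<Rightarrow> ('a \<Rightarrow> 'a) \<Rightarrow> bool" where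
  "solvable_twisted_conjugacy_problem F S \<phi> \<longleftrightarrow>
     (\<exists>d. partial_recursive 2 d \<and>
        (\<forall>u\<in>words (length S). \<forall>v\<in>words (length S).
           d [word_code u, word_code v] =
             Some (of_bool (\<exists>g\<in>carrier F.
               word_val F S v = inv\<^bsub>F\<^esub> g \<otimes>\<^bsub>F\<^esub> word_val F S u \<otimes>\<^bsub>F\<^esub> \<phi> g))))"

text \<open>
  The sequence predicates of \<open>HOL-Algebra.Exact_Sequence\<close> force all groups to have the same
  element type, hence the explicit definition here.
\<close>

definition short_exact ::
  "('a, 'k) monoid_scheme \<Rightarrow> ('b, 'l) monoid_scheme \<Rightarrow> ('c, 'm) monoid_scheme \<Rightarrow>
   ('a \<Rightarrow> 'b) \<Rightarrow> ('b \<Rightarrow> 'c) \<Rightarrow> bool" where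
  "short_exact F G H \<alpha> \<beta> \<longleftrightarrow>
     group F \<and> group G \<and> group H \<and> \<alpha> \<in> hom F G \<and> \<beta> \<in> hom G H \<and>
     inj_on \<alpha> (carrier F) \<and> \<alpha> ` carrier F = kernel G H \<beta> \<and> \<beta> ` carrier G = carrier H"

definition computable_short_exact ::
  "('a, 'k) monoid_scheme \<Rightarrow> 'a list \<Rightarrow> ('b, 'l) monoid_scheme \<Rightarrow> 'b list \<Rightarrow>
   ('c, 'm) monoid_scheme \<Rightarrow> 'c list \<Rightarrow> ('a \<Rightarrow> 'b) \<Rightarrow> ('b \<Rightarrow> 'c) \<Rightarrow> bool" where
  "computable_short_exact F SF G SG H SH \<alpha> \<beta> \<longleftrightarrow>
     short_exact F G H \<alpha> \<beta> \<and>
     can_compute word_code (words (length SF))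
       (\<lambda>w v. v \<in> words (length SG) \<and> word_val G SG v = \<alpha> (word_val F SF w)) \<and>
     can_compute word_code (words (length SG))
       (\<lambda>w v. v \<in> words (length SH) \<and> word_val H SH v = \<beta> (word_val G SG w)) \<and>
     can_compute word_code (words (length SH))
       (\<lambda>w v. v \<in> words (length SG) \<and> \<beta> (word_val G SG v) = word_val H SH w) \<and>
     can_compute word_code {w \<in> words (length SG). word_val G SG w \<in> \<alpha> ` carrier F}
       (\<lambda>w v. v \<in> words (length SF) \<and> \<alpha> (word_val F SF v) = word_val G SG w)"

text \<open>
  \<open>conj_action F G \<alpha> g\<close> is conjugation \<open>x \<mapsto> g\<inverse> x g\<close> by \<open>g\<close>, restricted to the normal
  subgroup \<open>\<alpha> ` carrier F\<close> and transported to \<open>F\<close> along \<open>\<alpha>\<close>. It is extensional on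
  \<open>carrier F\<close>, as automorphisms in \<open>auto F\<close> are.
\<close>

definition conj_action ::
  "('a, 'k) monoid_scheme \<Rightarrow> ('b, 'l) monoid_scheme \<Rightarrow> ('a \<Rightarrow> 'b) \<Rightarrow> 'b \<Rightarrow> 'a \<Rightarrow> 'a" where
  "conj_action F G \<alpha> g =
     (\<lambda>x\<in>carrier F. inv_into (carrier F) \<alpha> (inv\<^bsub>G\<^esub> g \<otimes>\<^bsub>G\<^esub> \<alpha> x \<otimes>\<^bsub>G\<^esub> g))"

definition action_subgroup ::
  "('a, 'k) monoid_scheme \<Rightarrow> ('b, 'l) monoid_scheme \<Rightarrow> ('a \<Rightarrow> 'b) \<Rightarrow> ('a \<Rightarrow> 'a) set" where
  "action_subgroup F G \<alpha> = conj_action F G \<alpha> ` carrier G"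

definition centralizer :: "('a, 'm) monoid_scheme \<Rightarrow> 'a \<Rightarrow> 'a set" where
  "centralizer G h = {x \<in> carrier G. x \<otimes>\<^bsub>G\<^esub> h = h \<otimes>\<^bsub>G\<^esub> x}"

text \<open>
  Left and right cosets of \<open>generate H {h}\<close> in \<open>centralizer H h\<close> coincide, because \<open>h\<close> is
  central there.
\<close>

definition centralizer_cosets :: "('a, 'm) monoid_scheme \<Rightarrow> 'a \<Rightarrow> 'a set set" where
  "centralizer_cosets H h = rcosets\<^bsub>H\<lparr>carrier := centralizer H h\<rparr>\<^esub> (generate H {h})"

text \<open>The output lists exactly one representative word for each coset.\<close>

definition computable_centralizer_transversals ::
  "('a, 'm) monoid_scheme \<Rightarrow> 'a list \<Rightarrow> bool" where
  "computable_centralizer_transversals H S \<longleftrightarrow>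
     can_compute (\<lambda>zs. list_encode (map word_code zs))
       {w \<in> words (length S). word_val H S w \<noteq> \<one>\<^bsub>H\<^esub>}
       (\<lambda>w zs. set zs \<subseteq> words (length S) \<and>
          word_val H S ` set zs \<subseteq> centralizer H (word_val H S w) \<and>
          bij_betw (\<lambda>i. generate H {word_val H S w} #>\<^bsub>H\<^esub> word_val H S (zs ! i))
            {..<length zs} (centralizer_cosets H (word_val H S w)))"

end

theory Submission
  imports Defs
begin

text \<open>
  Deciding the word problem of an extension splits along the short exact sequence. A word \<open>w\<close>
  of \<open>G\<close> can represent \<open>1\<close> only if \<open>\<beta> w\<close> does, which the word problem of \<open>H\<close> decides. If
  \<open>\<beta> w = 1\<close>, then exactness places \<open>w\<close> in \<open>\<alpha> F\<close>, so that its \<open>\<alpha>\<close>-preimage can be computed,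
  and since \<open>\<alpha>\<close> is injective, \<open>w\<close> represents \<open>1\<close> iff that preimage does, which the word problem
  of \<open>F\<close> decides. This is \<open>solvable_word_problem_extension\<close>. Computing the preimage may diverge
  when \<open>\<beta> w \<noteq> 1\<close>, so the second step must run only after the first has succeeded; this is what
  the lazy conditional \<open>partial_recursive_guard\<close> is for.

  The word problems of \<open>H\<close> and \<open>F\<close> come from the other two decision problems: the
  conjugacy class of \<open>1\<close> is \<open>{1}\<close>, and conjugacy is the \<open>\<phi>\<close>-twisted conjugacy of the identity
  \<open>\<phi>\<close>, which lies in the action subgroup as conjugation by \<open>1 \<in> G\<close>
  (\<open>solvable_word_problem_if_twisted_conjugacy\<close>).
\<close>

lemma partial_recursive_comp1:
  assumes "partial_recursive 1 f" "partial_recursive n g"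
  shows "partial_recursive n (\<lambda>xs. Option.bind (g xs) (\<lambda>y. f [y]))"
proof -
  have "partial_recursive n (\<lambda>xs. Option.bind (those (map (\<lambda>g. g xs) [g])) f)"
    using assms by (intro comp) auto
  moreover have "(\<lambda>xs. Option.bind (those (map (\<lambda>g. g xs) [g])) f)
      = (\<lambda>xs. Option.bind (g xs) (\<lambda>y. f [y]))"
    by (auto split: option.splits simp: fun_eq_iff bind_eq_None_conv bind_eq_Some_conv)
  ultimately show ?thesis by simp
qed

lemma partial_recursive_comp2:
  assumes "partial_recursive 2 f" "partial_recursive n g" "partial_recursive n h"
  shows "partial_recursive n (\<lambda>xs. Option.bind (g xs) (\<lambda>y. Option.bind (h xs) (\<lambda>z. f [y, z])))"
proof -
  have "partial_recursive n (\<lambda>xs. Option.bind (those (map (\<lambda>g. g xs) [g, h])) f)"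
    using assms by (intro comp) (auto simp: numeral_2_eq_2)
  moreover have "(\<lambda>xs. Option.bind (those (map (\<lambda>g. g xs) [g, h])) f)
      = (\<lambda>xs. Option.bind (g xs) (\<lambda>y. Option.bind (h xs) (\<lambda>z. f [y, z])))"
  proof
    fix xs
    show "Option.bind (those (map (\<lambda>g. g xs) [g, h])) f
      = Option.bind (g xs) (\<lambda>y. Option.bind (h xs) (\<lambda>z. f [y, z]))"
      by (cases "g xs"; cases "h xs") auto
  qed
  ultimately show ?thesis by simp
qed

text \<open>
  Composition is strict, so a conditional built from it diverges whenever one of its branches
  does. Primitive recursion is lazy: its step function is not run at all when the recursion
  argument is \<open>0\<close>. A recursion on the truth value of the guard thus runs \<open>q\<close> only if the guard
  holds.
\<close>

lemma partial_recursive_guard: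
  assumes p: "partial_recursive 1 p" and q: "partial_recursive 1 q"
  obtains d where "partial_recursive 1 d"
    "\<And>x. p [x] = Some 0 \<Longrightarrow> d [x] = Some 0"
    "\<And>x. p [x] = Some 1 \<Longrightarrow> d [x] = q [x]"
proof -
  \<comment> \<open>The step receives the counter, the previous value and \<open>x\<close>, in this order.\<close>
  define step where "step = (\<lambda>xs :: nat list. Option.bind (Some (xs ! 2)) (\<lambda>y. q [y]))"
  define r where "r = (\<lambda>xs :: nat list. rec_nat (Some 0)
    (\<lambda>k r. Option.bind r (\<lambda>v. step (k # v # tl xs))) (hd xs))"
  define d where "d = (\<lambda>xs. Option.bind (p xs) (\<lambda>y. Option.bind (Some (xs ! 0)) (\<lambda>z. r [y, z])))"
  have "partial_recursive (1 + 2) step"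
    unfolding step_def by (intro partial_recursive_comp1 q proj) simp
  hence "partial_recursive (1 + 1) r"
    unfolding r_def by (intro prim_rec partial_recursive.zero)
  hence "partial_recursive 2 r" by (simp only: one_add_one)
  hence "partial_recursive 1 d"
    unfolding d_def by (intro partial_recursive_comp2 p proj) simp_all
  thus thesis
    by (rule that) (simp_all add: d_def r_def step_def)
qed

lemma word_val_Nil [simp]: "word_val K S [] = \<one>\<^bsub>K\<^esub>"
  by (simp add: word_val_def)

lemma Nil_in_words [simp]: "[] \<in> words n"
  by (simp add: words_def)

lemma word_code_Nil [simp]: "word_code [] = 0"
  by (simp add: word_code_def)

lemma (in group) word_val_closed:
  assumes "set S \<subseteq> carrier G" "w \<in> words (length S)"
  shows "word_val G S w \<in> carrier G"
  using assms(2)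
proof (induction w)
  case Nil
  show ?case by simp
next
  case (Cons l w)
  have "letter_val G S l \<in> carrier G"
    using Cons.prems assms(1) by (cases l) (auto simp: words_def subset_code(1))
  moreover have "word_val G S w \<in> carrier G"
    using Cons by (simp add: words_def)
  moreover have "word_val G S (l # w) = letter_val G S l \<otimes> word_val G S w"
    by (simp add: word_val_def)
  ultimately show ?case by simp
qed

lemma solvable_conjugacy_problem_iff_twisted:
  "solvable_conjugacy_problem K S \<longleftrightarrow> solvable_twisted_conjugacy_problem K S (\<lambda>x. x)"
  by (simp add: solvable_conjugacy_problem_def solvable_twisted_conjugacy_problem_def)

text \<open>The only conjugate of \<open>1\<close> is \<open>1\<close>, so it suffices to compare a word with the empty word.\<close>

lemma (in group) solvable_word_problem_if_twisted_conjugacy: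
  assumes S: "set S \<subseteq> carrier G" and \<phi>: "\<And>x. x \<in> carrier G \<Longrightarrow> \<phi> x = x"
    and dec: "solvable_twisted_conjugacy_problem G S \<phi>"
  shows "solvable_word_problem G S"
proof -
  obtain d where d: "partial_recursive 2 d" and d_dec: "\<forall>u\<in>words (length S). \<forall>v\<in>words (length S).
      d [word_code u, word_code v] = Some (of_bool (\<exists>g\<in>carrier G.
        word_val G S v = inv g \<otimes> word_val G S u \<otimes> \<phi> g))"
    using dec unfolding solvable_twisted_conjugacy_problem_def by blast
  define e where "e = (\<lambda>xs. Option.bind (Some 0) (\<lambda>y. Option.bind (Some (xs ! 0)) (\<lambda>z. d [y, z])))"
  have "partial_recursive 1 e"
    unfolding e_def by (intro partial_recursive_comp2 d partial_recursive.zero proj) simp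
  moreover have "e [word_code w] = Some (of_bool (word_val G S w = \<one>))"
    if w: "w \<in> words (length S)" for w
  proof -
    have "inv g \<otimes> \<one> \<otimes> \<phi> g = \<one>" if "g \<in> carrier G" for g
      using that by (simp add: \<phi>)
    hence "(\<exists>g\<in>carrier G. word_val G S w = inv g \<otimes> word_val G S [] \<otimes> \<phi> g)
        \<longleftrightarrow> word_val G S w = \<one>"
      by auto
    thus ?thesis
      using d_dec[rule_format, of "[]" w] w by (simp add: e_def)
  qed
  ultimately show ?thesis
    unfolding solvable_word_problem_def by blast
qed

lemma conj_action_one:
  assumes "group G" "\<alpha> \<in> hom F G" "inj_on \<alpha> (carrier F)" "x \<in> carrier F"
  shows "conj_action F G \<alpha> \<one>\<^bsub>G\<^esub> x = x"
proof -
  interpret G: group G by fact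
  have "\<alpha> x \<in> carrier G" using assms by (auto simp: hom_def)
  thus ?thesis using assms by (simp add: conj_action_def)
qed

lemma short_exact_eq_one_iff:
  assumes ex: "short_exact F G H \<alpha> \<beta>" and g: "g \<in> carrier G"
  shows "\<beta> g = \<one>\<^bsub>H\<^esub> \<longleftrightarrow> g \<in> \<alpha> ` carrier F"
    and "x \<in> carrier F \<Longrightarrow> \<alpha> x = g \<Longrightarrow> g = \<one>\<^bsub>G\<^esub> \<longleftrightarrow> x = \<one>\<^bsub>F\<^esub>"
proof -
  interpret \<alpha>: group_hom F G \<alpha>
    using ex by (simp add: short_exact_def group_hom_def group_hom_axioms_def)
  show "\<beta> g = \<one>\<^bsub>H\<^esub> \<longleftrightarrow> g \<in> \<alpha> ` carrier F"
    using ex g by (simp add: short_exact_def kernel_def)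
  show "g = \<one>\<^bsub>G\<^esub> \<longleftrightarrow> x = \<one>\<^bsub>F\<^esub>" if x: "x \<in> carrier F" and "\<alpha> x = g"
  proof -
    have "inj_on \<alpha> (carrier F)" using ex by (simp add: short_exact_def)
    hence "\<alpha> x = \<alpha> \<one>\<^bsub>F\<^esub> \<longleftrightarrow> x = \<one>\<^bsub>F\<^esub>"
      using x \<alpha>.G.one_closed by (rule inj_on_eq_iff)
    thus ?thesis using \<open>\<alpha> x = g\<close> by simp
  qed
qed

lemma solvable_word_problem_extension:
  assumes ex: "short_exact F G H \<alpha> \<beta>"
    and SF: "set SF \<subseteq> carrier F" and SG: "set SG \<subseteq> carrier G"
    and comp_\<beta>: "can_compute word_code (words (length SG))
       (\<lambda>w v. v \<in> words (length SH) \<and> word_val H SH v = \<beta> (word_val G SG w))"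
    and comp_pre: "can_compute word_code {w \<in> words (length SG). word_val G SG w \<in> \<alpha> ` carrier F}
       (\<lambda>w v. v \<in> words (length SF) \<and> \<alpha> (word_val F SF v) = word_val G SG w)"
    and F_dec: "solvable_word_problem F SF" and H_dec: "solvable_word_problem H SH"
  shows "solvable_word_problem G SG"
proof -
  interpret F: group F using ex by (simp add: short_exact_def)
  interpret G: group G using ex by (simp add: short_exact_def)
  obtain b where b: "partial_recursive 1 b" and b_spec: "\<forall>w\<in>words (length SG). \<exists>v.
      b [word_code w] = Some (word_code v) \<and>
      v \<in> words (length SH) \<and> word_val H SH v = \<beta> (word_val G SG w)"
    using comp_\<beta> unfolding can_compute_def by blast
  obtain a where a: "partial_recursive 1 a"
    and a_spec: "\<forall>w\<in>{w \<in> words (length SG). word_val G SG w \<in> \<alpha> ` carrier F}. \<exists>v.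
      a [word_code w] = Some (word_code v) \<and>
      v \<in> words (length SF) \<and> \<alpha> (word_val F SF v) = word_val G SG w"
    using comp_pre unfolding can_compute_def by blast
  obtain dF where dF: "partial_recursive 1 dF" and dF_spec: "\<forall>w\<in>words (length SF).
      dF [word_code w] = Some (of_bool (word_val F SF w = \<one>\<^bsub>F\<^esub>))"
    using F_dec unfolding solvable_word_problem_def by blast
  obtain dH where dH: "partial_recursive 1 dH" and dH_spec: "\<forall>w\<in>words (length SH).
      dH [word_code w] = Some (of_bool (word_val H SH w = \<one>\<^bsub>H\<^esub>))"
    using H_dec unfolding solvable_word_problem_def by blast
  define p where "p = (\<lambda>xs. Option.bind (b xs) (\<lambda>y. dH [y]))"
  define q where "q = (\<lambda>xs. Option.bind (a xs) (\<lambda>y. dF [y]))"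
  have "partial_recursive 1 p" "partial_recursive 1 q"
    unfolding p_def q_def by (intro partial_recursive_comp1 a b dF dH)+
  then obtain d where d: "partial_recursive 1 d"
    and d_0: "\<And>x. p [x] = Some 0 \<Longrightarrow> d [x] = Some 0"
    and d_1: "\<And>x. p [x] = Some 1 \<Longrightarrow> d [x] = q [x]"
    by (rule partial_recursive_guard) blast
  have "d [word_code w] = Some (of_bool (word_val G SG w = \<one>\<^bsub>G\<^esub>))"
    if w: "w \<in> words (length SG)" for w
  proof -
    let ?g = "word_val G SG w"
    have g: "?g \<in> carrier G" using G.word_val_closed[OF SG w] .
    obtain v where "b [word_code w] = Some (word_code v)" "v \<in> words (length SH)"
      "word_val H SH v = \<beta> ?g"
      using b_spec w by blast
    hence p_w: "p [word_code w] = Some (of_bool (\<beta> ?g = \<one>\<^bsub>H\<^esub>))"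
      using dH_spec by (simp add: p_def)
    show ?thesis
    proof (cases "\<beta> ?g = \<one>\<^bsub>H\<^esub>")
      case True
      with short_exact_eq_one_iff(1)[OF ex g] have "?g \<in> \<alpha> ` carrier F" by blast
      then obtain u where u: "a [word_code w] = Some (word_code u)"
        "u \<in> words (length SF)" "\<alpha> (word_val F SF u) = ?g"
        using a_spec w by blast
      have "?g = \<one>\<^bsub>G\<^esub> \<longleftrightarrow> word_val F SF u = \<one>\<^bsub>F\<^esub>"
        using short_exact_eq_one_iff(2)[OF ex g F.word_val_closed[OF SF u(2)] u(3)] .
      moreover have "d [word_code w] = q [word_code w]"
        using p_w True by (intro d_1) simp
      ultimately show ?thesis using u dF_spec by (simp add: q_def)
    next
      case False
      \<comment> \<open>\<open>1\<close> lies in the image of \<open>F\<close>, hence in the kernel of \<open>\<beta>\<close>.\<close>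
      have "\<beta> \<one>\<^bsub>G\<^esub> = \<one>\<^bsub>H\<^esub>"
        using ex by (auto simp: short_exact_def intro: hom_one)
      with False have "?g \<noteq> \<one>\<^bsub>G\<^esub>" by metis
      moreover have "d [word_code w] = Some 0"
        using p_w False by (intro d_0) simp
      ultimately show ?thesis by simp
    qed
  qed
  with d show ?thesis unfolding solvable_word_problem_def by blast
qed

theorem theorem3:
  fixes F :: "('a, 'k) monoid_scheme" and G :: "('b, 'l) monoid_scheme"
    and H :: "('c, 'm) monoid_scheme"
    and SF :: "'a list" and SG :: "'b list" and SH :: "'c list"
    and \<alpha> :: "'a \<Rightarrow> 'b" and \<beta> :: "'b \<Rightarrow> 'c"
  assumes "generating_family F SF" and "generating_family G SG" and "generating_family H SH"
    and "computable_short_exact F SF G SG H SH \<alpha> \<beta>"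
    and "\<And>\<phi>. \<phi> \<in> action_subgroup F G \<alpha> \<Longrightarrow> solvable_twisted_conjugacy_problem F SF \<phi>"
    and "solvable_conjugacy_problem H SH"
    and "\<And>h. h \<in> carrier H \<Longrightarrow> h \<noteq> \<one>\<^bsub>H\<^esub> \<Longrightarrow> finite (centralizer_cosets H h)"
    and "computable_centralizer_transversals H SH"
  shows "solvable_word_problem G SG"
proof -
  have ex: "short_exact F G H \<alpha> \<beta>"
    using assms(4) by (simp add: computable_short_exact_def)
  interpret F: group F using ex by (simp add: short_exact_def)
  interpret G: group G using ex by (simp add: short_exact_def)
  interpret H: group H using ex by (simp add: short_exact_def)
  have SF: "set SF \<subseteq> carrier F" and SG: "set SG \<subseteq> carrier G" and SH: "set SH \<subseteq> carrier H"
    using assms(1-3) by (simp_all add: generating_family_def)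
  have "conj_action F G \<alpha> \<one>\<^bsub>G\<^esub> \<in> action_subgroup F G \<alpha>"
    by (simp add: action_subgroup_def)
  from assms(5)[OF this] have "solvable_word_problem F SF"
    using ex by (intro F.solvable_word_problem_if_twisted_conjugacy[OF SF])
      (auto simp: short_exact_def intro: conj_action_one)
  moreover have "solvable_word_problem H SH"
    using H.solvable_word_problem_if_twisted_conjugacy[OF SH refl] assms(6)
    by (simp add: solvable_conjugacy_problem_iff_twisted)
  ultimately show ?thesis
    using assms(4) unfolding computable_short_exact_def
    by (intro solvable_word_problem_extension[OF ex SF SG]) blast+
qed

end
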